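(* Let $w_1,w_2,w_3$ be any odd positive integers. Then for every integer $n\ge 0$, \begin{align*} &\sum_{k+l+m=n}\binom{n}{k,l,m}T_k(w_1d-1,\chi)T_l(w_2d-1,\chi)T_m(w_3d-1,\chi)\,w_{3}^{k}w_{1}^{l}w_{2}^{m}\\ =&\sum_{k+l+m=n}\binom{n}{k,l,m}T_k(w_1d-1,\chi)T_l(w_3d-1,\chi)T_m(w_2d-1,\chi)\,w_{2}^{k}w_{1}^{l}w_{3}^{m}. \end{align*} Here each sum is over all nonnegative integers $k,l,m$ with $k+l+m=n$.
   Context: $p$ is a fixed odd prime and $\mathbb{C}_p$ is the completion of an algebraic closure of $\mathbb{Q}_p$. $d$ is a fixed odd positive integer and $\chi$ is a (primitive) Dirichlet character of conductor $d$, with values in $\overline{\mathbb{Q}}$, regarded as $\mathbb{C}_p$-valued through a fixed embedding $\overline{\mathbb{Q}}\to\mathbb{C}_p$; as usual $\chi(a)=0$ when $\gcd(a,d)>1$ (and $\chi\equiv 1$ if $d=1$). For integers $k,n\ge 0$, the $k$th alternating generalized power sum attached to $\chi$ is $T_k(n,\chi)=\sum_{a=0}^{n}(-1)^a\chi(a)a^k$, with the convention $0^0=1$. The multinomial coefficient is $\binom{n}{k,l,m}=\frac{n!}{k!\,l!\,m!}$. *)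

theory Defs
  imports "HOL-Analysis.Analysis" "HOL-Computational_Algebra.Computational_Algebra"
begin

text \<open>Absolute values are rendered as explicit functions \<open>v\<close> on a field, since \<open>\<complex>\<^sub>p\<close> carries no
  real normed structure; completeness and closures refer to the metric \<open>v (x - y)\<close>.\<close>

definition nonarch_absval :: "('a::field \<Rightarrow> real) \<Rightarrow> bool" where
  "nonarch_absval v \<longleftrightarrow>
     (\<forall>x. v x \<ge> 0) \<and> (\<forall>x. v x = 0 \<longleftrightarrow> x = 0) \<and>
     (\<forall>x y. v (x * y) = v x * v y) \<and> (\<forall>x y. v (x + y) \<le> max (v x) (v y))"

definition absval_complete :: "('a::field \<Rightarrow> real) \<Rightarrow> bool" where
  "absval_complete v \<longleftrightarrow> Metric_space.mcomplete UNIV (\<lambda>x y. v (x - y))"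

definition absval_closure :: "('a::field \<Rightarrow> real) \<Rightarrow> 'a set \<Rightarrow> 'a set" where
  "absval_closure v S = Metric_space.mtopology UNIV (\<lambda>x y. v (x - y)) closure_of S"

definition algebraic_elements_over :: "'a::field set \<Rightarrow> 'a set" where
  "algebraic_elements_over F =
     {x. \<exists>f. f \<noteq> 0 \<and> (\<forall>i. coeff f i \<in> F) \<and> poly f x = 0}"

definition algebraically_closed_subfield :: "'a::field set \<Rightarrow> bool" where
  "algebraically_closed_subfield L \<longleftrightarrow>
     (\<forall>f. degree f > 0 \<and> (\<forall>i. coeff f i \<in> L) \<longrightarrow> (\<exists>x\<in>L. poly f x = 0))"

text \<open>\<open>is_Cp p v\<close>: the whole type \<open>'a\<close>, with absolute value \<open>v\<close>, is (a model of) \<open>\<complex>\<^sub>p\<close>.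
  The absolute value restricts to the \<open>p\<close>-adic one on \<open>\<rat>\<close> (by \<open>v p = 1/p\<close> and the
  ultrametric inequality), so in the complete field \<open>'a\<close> the closure of \<open>\<rat>\<close> is \<open>\<rat>\<^sub>p\<close>.
  The elements algebraic over it form an algebraic closure of \<open>\<rat>\<^sub>p\<close>, and \<open>'a\<close> is the
  completion of that.  This determines \<open>('a, v)\<close> up to isometric isomorphism.\<close>

definition is_Cp :: "nat \<Rightarrow> ('a::field_char_0 \<Rightarrow> real) \<Rightarrow> bool" where
  "is_Cp p v \<longleftrightarrow>
     nonarch_absval v \<and> v (of_nat p) = 1 / real p \<and> absval_complete v \<and>
     (let Qp = absval_closure v \<rat>; Qpbar = algebraic_elements_over Qp
      in algebraically_closed_subfield Qpbar \<and> absval_closure v Qpbar = UNIV)"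

definition Qbar :: "complex set" where
  "Qbar = {z. algebraic z}"

definition Qbar_embedding :: "(complex \<Rightarrow> 'a::field) \<Rightarrow> bool" where
  "Qbar_embedding \<iota> \<longleftrightarrow>
     \<iota> 1 = 1 \<and> inj_on \<iota> Qbar \<and>
     (\<forall>x\<in>Qbar. \<forall>y\<in>Qbar. \<iota> (x + y) = \<iota> x + \<iota> y \<and> \<iota> (x * y) = \<iota> x * \<iota> y)"

definition dirichlet_character :: "nat \<Rightarrow> (int \<Rightarrow> complex) \<Rightarrow> bool" where
  "dirichlet_character m chi \<longleftrightarrow>
     m > 0 \<and> (\<forall>a. chi (a + int m) = chi a) \<and> chi 1 = 1 \<and>
     (\<forall>a b. chi (a * b) = chi a * chi b) \<and> (\<forall>a. chi a = 0 \<longleftrightarrow> \<not> coprime a (int m))"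

definition induced_from :: "nat \<Rightarrow> (int \<Rightarrow> complex) \<Rightarrow> nat \<Rightarrow> bool" where
  "induced_from m chi e \<longleftrightarrow>
     e dvd m \<and> (\<exists>psi. dirichlet_character e psi \<and> (\<forall>a. coprime a (int m) \<longrightarrow> chi a = psi a))"

definition conductor :: "nat \<Rightarrow> (int \<Rightarrow> complex) \<Rightarrow> nat" where
  "conductor m chi = (LEAST e. induced_from m chi e)"

definition primitive_character :: "nat \<Rightarrow> (int \<Rightarrow> complex) \<Rightarrow> bool" where
  "primitive_character d chi \<longleftrightarrow> dirichlet_character d chi \<and> conductor d chi = d"

definition alt_power_sum :: "nat \<Rightarrow> nat \<Rightarrow> (int \<Rightarrow> 'a::field) \<Rightarrow> 'a" where
  "alt_power_sum k n chi = (\<Sum>a=0..n. (-1) ^ a * chi (int a) * of_nat a ^ k)"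

definition multinomial3 :: "nat \<Rightarrow> nat \<Rightarrow> nat \<Rightarrow> nat \<Rightarrow> 'a::field_char_0" where
  "multinomial3 n k l m = fact n / (fact k * fact l * fact m)"

end

theory Submission
  imports Defs
begin

text \<open>The exponential generating function of \<open>T\<^sub>k (w d - 1, \<chi>)\<close> is the twisted exponential sum
  \<open>S\<^sub>w(t) = \<Sum>a<wd. (-1)\<^sup>a \<chi>(a) e\<^bsup>at\<^esup>\<close>. As \<open>d\<close> and \<open>w\<close> are odd and \<open>\<chi>\<close> has period \<open>d\<close>, splitting into
  blocks of length \<open>d\<close> gives \<open>S\<^sub>w(t) = S\<^sub>1(t) (1 + e\<^bsup>wdt\<^esup>) / (1 + e\<^bsup>dt\<^esup>)\<close>. The two sides of the theorem
  are the coefficients of \<open>S\<^bsub>w1\<^esub>(w3 t) S\<^bsub>w2\<^esub>(w1 t) S\<^bsub>w3\<^esub>(w2 t)\<close> and \<open>S\<^bsub>w1\<^esub>(w2 t) S\<^bsub>w3\<^esub>(w1 t) S\<^bsub>w2\<^esub>(w3 t)\<close>,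
  and both products equal the same symmetric expression in \<open>w1, w2, w3\<close>.\<close>

text \<open>The argument \<open>x\<close> rescales the variable: for \<open>N = w * d\<close> this
  is \<open>S\<^sub>w(x t)\<close>.\<close>

definition alt_exp_sum :: "(int \<Rightarrow> 'a::field_char_0) \<Rightarrow> nat \<Rightarrow> 'a \<Rightarrow> 'a fps" where
  "alt_exp_sum f N x = (\<Sum>a<N. fps_const ((-1) ^ a * f (int a)) * fps_exp (of_nat a * x))"

text \<open>Positivity of \<open>N\<close> matters: at \<open>N = 0\<close> the truncated
  \<open>N - 1\<close> would keep the term \<open>a = 0\<close> on the right.\<close>

lemma alt_exp_sum_nth:
  assumes "N > 0"
  shows "alt_exp_sum f N x $ k = alt_power_sum k (N - 1) f * x ^ k / fact k"
proof -
  have "{0..N - 1} = {..<N}" using assms by auto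
  then show ?thesis
    by (simp add: alt_exp_sum_def alt_power_sum_def fps_sum_nth sum_distrib_right
        sum_divide_distrib power_mult_distrib mult.assoc)
qed

lemma sum_lessThan_add:
  fixes g :: "nat \<Rightarrow> 'b::comm_monoid_add"
  shows "(\<Sum>a<m + n. g a) = (\<Sum>a<m. g a) + (\<Sum>a<n. g (m + a))"
  by (induction n) (simp_all add: add.assoc)

text \<open>Since \<open>d\<close> is odd, shifting by \<open>w * d\<close> multiplies the first
  block by \<open>(-1) ^ w\<close> and an exponential. The blocks thus form a geometric sum of ratio
  -e^(dxt), which the factor on the left telescopes without any division.\<close>

lemma alt_exp_sum_blocks:
  fixes f :: "int \<Rightarrow> 'a::field_char_0"
  assumes per: "\<And>a. f (a + int d) = f a" and "odd d"
  shows "alt_exp_sum f (w * d) x * (1 + fps_exp (of_nat d * x))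
       = alt_exp_sum f d x * (1 - (-1) ^ w * fps_exp (of_nat (w * d) * x))"
proof (induction w)
  case 0
  show ?case by (simp add: alt_exp_sum_def)
next
  case (Suc w)
  have perw: "f (int (w * d + a)) = f (int a)" for a
  proof (induction w)
    case (Suc w)
    then show ?case using per[of "int (w * d + a)"] by (simp add: algebra_simps)
  qed simp
  have shifted: "fps_const ((-1) ^ (w * d + a) * f (int (w * d + a))) * fps_exp (of_nat (w * d + a) * x)
      = (-1) ^ w * fps_exp (of_nat (w * d) * x)
          * (fps_const ((-1) ^ a * f (int a)) * fps_exp (of_nat a * x))" for a
  proof -
    have sgn: "(-1 :: 'a) ^ (w * d + a) = (-1) ^ w * (-1) ^ a"
      using \<open>odd d\<close> by (simp add: power_add minus_one_power_iff)
    have c: "(-1 :: 'a fps) ^ w = fps_const ((-1) ^ w)"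
      by (simp add: minus_one_power_iff)
    have e: "fps_exp (of_nat (w * d + a) * x) = fps_exp (of_nat (w * d) * x) * fps_exp (of_nat a * x)"
      by (simp only: of_nat_add distrib_right fps_exp_add_mult)
    show ?thesis unfolding perw sgn c e
      by (simp only: fps_const_mult[symmetric] mult_ac)
  qed
  have "alt_exp_sum f (Suc w * d) x = alt_exp_sum f (w * d + d) x"
    by (simp add: add.commute)
  also have "\<dots> = alt_exp_sum f (w * d) x
      + (\<Sum>a<d. fps_const ((-1) ^ (w * d + a) * f (int (w * d + a))) * fps_exp (of_nat (w * d + a) * x))"
    unfolding alt_exp_sum_def by (rule sum_lessThan_add)
  also have "\<dots> = alt_exp_sum f (w * d) x
      + (-1) ^ w * fps_exp (of_nat (w * d) * x) * alt_exp_sum f d x"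
    unfolding shifted by (simp only: sum_distrib_left alt_exp_sum_def)
  finally have step: "alt_exp_sum f (Suc w * d) x = \<dots>" .
  have e: "fps_exp (of_nat (Suc w * d) * x) = fps_exp (of_nat (w * d) * x) * fps_exp (of_nat d * x)"
    by (simp add: fps_exp_add_mult[symmetric] algebra_simps)
  show ?case unfolding step distrib_right Suc.IH e
    by (simp add: algebra_simps)
qed

lemma alt_exp_sum_odd:
  fixes f :: "int \<Rightarrow> 'a::field_char_0"
  assumes "\<And>a. f (a + int d) = f a" and "odd d" and "odd w"
  shows "alt_exp_sum f (w * d) (of_nat y) * (1 + fps_exp (of_nat (d * y)))
       = alt_exp_sum f d (of_nat y) * (1 + fps_exp (of_nat (w * y * d)))"
  using alt_exp_sum_blocks[of f d w "of_nat y", OF assms(1,2)] \<open>odd w\<close>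
  by (simp add: mult_ac)

lemma one_plus_fps_exp_nonzero: "1 + fps_exp c \<noteq> (0 :: 'a::field_char_0 fps)"
proof
  assume "1 + fps_exp c = (0 :: 'a fps)"
  then have "(1 + fps_exp c) $ 0 = (0 :: 'a)" by simp
  then show False by simp
qed

text \<open>Once denominators are cleared, each side contains every S_1(w_i t) once, and numerators
  that depend only on the products \<open>w * y\<close>. Both sides pair the weights as {w1,w3},
  {w1,w2}, {w2,w3}.\<close>

lemma alt_exp_sum_product_swap:
  fixes f :: "int \<Rightarrow> 'a::field_char_0"
  assumes per: "\<And>a. f (a + int d) = f a" and d: "odd d"
    and w1: "odd w1" and w2: "odd w2" and w3: "odd w3"
  shows "alt_exp_sum f (w1 * d) (of_nat w3) * alt_exp_sum f (w2 * d) (of_nat w1)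
          * alt_exp_sum f (w3 * d) (of_nat w2)
       = alt_exp_sum f (w1 * d) (of_nat w2) * alt_exp_sum f (w3 * d) (of_nat w1)
          * alt_exp_sum f (w2 * d) (of_nat w3)" (is "?L = ?R")
proof -
  define D where "D y = 1 + (fps_exp (of_nat (d * y)) :: 'a fps)" for y
  define G where "G u = 1 + (fps_exp (of_nat (u * d)) :: 'a fps)" for u
  have key: "alt_exp_sum f (w * d) (of_nat y) * D y = alt_exp_sum f d (of_nat y) * G (w * y)"
    if "odd w" for w y
    unfolding D_def G_def by (rule alt_exp_sum_odd[of f, OF per d that])
  have "?L * (D w3 * D w1 * D w2)
      = (alt_exp_sum f (w1 * d) (of_nat w3) * D w3) * (alt_exp_sum f (w2 * d) (of_nat w1) * D w1)
          * (alt_exp_sum f (w3 * d) (of_nat w2) * D w2)"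
    by (simp only: mult_ac)
  also have "\<dots> = (alt_exp_sum f (w1 * d) (of_nat w2) * D w2)
      * (alt_exp_sum f (w3 * d) (of_nat w1) * D w1) * (alt_exp_sum f (w2 * d) (of_nat w3) * D w3)"
    unfolding key[OF w1] key[OF w2] key[OF w3] by (simp only: mult_ac)
  also have "\<dots> = ?R * (D w3 * D w1 * D w2)"
    by (simp only: mult_ac)
  \<comment> \<open>Power series over a field form an integral domain, so the nonzero factors
    \<open>D\<close> cancel.\<close>
  finally show ?thesis
    by (simp add: D_def one_plus_fps_exp_nonzero)
qed

lemma fps_mult3_nth:
  fixes F G H :: "'a::comm_semiring_1 fps"
  shows "(F * G * H) $ n = (\<Sum>(k, l, m) \<in> {(k, l, m). k + l + m = n}. F $ k * G $ l * H $ m)"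
proof -
  have "(F * G * H) $ n
      = (\<Sum>(i, k) \<in> (SIGMA i:{0..n}. {0..i}). F $ k * G $ (i - k) * H $ (n - i))"
    by (simp add: fps_mult_nth sum_distrib_right sum.Sigma)
  \<comment> \<open>In the nested Cauchy product, \<open>i\<close> is the degree contributed by
    \<open>F * G\<close>, hence \<open>i = k + l\<close>.\<close>
  also have "\<dots> = (\<Sum>(k, l, m) \<in> {(k, l, m). k + l + m = n}. F $ k * G $ l * H $ m)"
    by (rule sum.reindex_bij_witness[where i = "\<lambda>(k, l, m). (k + l, k)"
          and j = "\<lambda>(i, k). (k, i - k, n - i)"]) auto
  finally show ?thesis .
qed

text \<open>The three factorials in the multinomial coefficient are the denominators of the
  exponential coefficients.\<close>

lemma multinomial_alt_power_sum:
  fixes f :: "int \<Rightarrow> 'a::field_char_0"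
  assumes "A > 0" and "B > 0" and "C > 0"
  shows "(\<Sum>(k, l, m) \<in> {(k, l, m). k + l + m = n}.
        multinomial3 n k l m * alt_power_sum k (A - 1) f * alt_power_sum l (B - 1) f
          * alt_power_sum m (C - 1) f * x ^ k * y ^ l * z ^ m)
      = fact n * (alt_exp_sum f A x * alt_exp_sum f B y * alt_exp_sum f C z) $ n"
  unfolding fps_mult3_nth sum_distrib_left
  by (intro sum.cong)
    (auto simp: alt_exp_sum_nth assms multinomial3_def field_simps)

theorem theorem4p8:
  fixes p d w1 w2 w3 n :: nat
    and v :: "'a::field_char_0 \<Rightarrow> real"
    and \<iota> :: "complex \<Rightarrow> 'a"
    and chi :: "int \<Rightarrow> complex"
  assumes "prime p" and "odd p"
    and "is_Cp p v"
    and "Qbar_embedding \<iota>"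
    and "d > 0" and "odd d"
    and "primitive_character d chi" and "range chi \<subseteq> Qbar"
    and "w1 > 0" and "odd w1"
    and "w2 > 0" and "odd w2"
    and "w3 > 0" and "odd w3"
  shows
    "(\<Sum>(k, l, m) \<in> {(k, l, m). k + l + m = n}.
        multinomial3 n k l m
          * alt_power_sum k (w1 * d - 1) (\<iota> \<circ> chi)
          * alt_power_sum l (w2 * d - 1) (\<iota> \<circ> chi)
          * alt_power_sum m (w3 * d - 1) (\<iota> \<circ> chi)
          * of_nat w3 ^ k * of_nat w1 ^ l * of_nat w2 ^ m)
   = (\<Sum>(k, l, m) \<in> {(k, l, m). k + l + m = n}.
        multinomial3 n k l m
          * alt_power_sum k (w1 * d - 1) (\<iota> \<circ> chi)
          * alt_power_sum l (w3 * d - 1) (\<iota> \<circ> chi)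
          * alt_power_sum m (w2 * d - 1) (\<iota> \<circ> chi)
          * of_nat w2 ^ k * of_nat w1 ^ l * of_nat w3 ^ m)"
proof -
  have "dirichlet_character d chi"
    using assms(7) by (simp add: primitive_character_def)
  then have per: "(\<iota> \<circ> chi) (a + int d) = (\<iota> \<circ> chi) a" for a
    by (simp add: dirichlet_character_def)
  have pos: "w1 * d > 0" "w2 * d > 0" "w3 * d > 0"
    using assms by auto
  show ?thesis
    \<comment> \<open>The right-hand side lists the ranges in the order w1, w3, w2.\<close>
    unfolding multinomial_alt_power_sum[OF pos] multinomial_alt_power_sum[OF pos(1,3,2)]
    by (simp only: alt_exp_sum_product_swap[of "\<iota> \<circ> chi", OF per assms(6,10,12,14)])
qed

end
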